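(* Let $\eta:A^*\to A^*$ be a substitution and $u\in A^{\mathbb{Z}}$ a two-sided periodic point of $\eta$ with growing seed $s=u_{-1}|u_0$. Then for every $n\in\mathbb{Z}$, \[ u_n=\mathcal{A}_{\eta,s}(\mathrm{rep}_u(n)). \]
   Context: $A$ is a finite alphabet, $A^*$ the finite words, $\varepsilon$ the empty word, $|w|$ the length, $w[i]$ the $i$-th letter (from $0$). A substitution is a morphism $\eta:A^*\to A^*$ with $\eta(a)\neq\varepsilon$ for all $a$ and some letter growing ($|\eta^k(a)|\to\infty$). $\eta$ acts on $u\in A^{\mathbb{Z}}$ by $\eta(\cdots u_{-2}u_{-1}|u_0u_1\cdots)=\cdots\eta(u_{-2})\eta(u_{-1})|\eta(u_0)\eta(u_1)\cdots$, where $|$ separates positions $-1$ and $0$. $u$ is a periodic point if $\eta^p(u)=u$ for some $p\ge1$; its period is the least such $p$; its seed is $u_{-1}|u_0$, called growing if both letters are growing. A sequence $(m_i,a_i)_{i=0,\dots,k}$ in $A^*\times A$ is $x$-admissible if $m_{i-1}a_{i-1}$ is a prefix of $\eta(a_i)$ for $1\le i\le k$ and $m_ka_k$ is a prefix of $\eta(x)$. Let $\mathcal{D}=\{0,\dots,\max_{c}|\eta(c)|-1\}$; $\odot$ is concatenation of words over $\mathcal{D}$. Numeration system: let $p$ be the period of $u$. For $n\ge1$ there are a unique $k$ divisible by $p$ and a unique $u_0$-admissible $(m_i,a_i)_{i=0,\dots,k-1}$ with $m_{k-1}\cdots m_{k-p}\ne\varepsilon$ and $u_0\cdots u_{n-1}=\eta^{k-1}(m_{k-1})\cdots\eta^0(m_0)$;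 for $n\le-2$ there are a unique $k$ divisible by $p$ and a unique $u_{-1}$-admissible $(m_i,a_i)_{i=0,\dots,k-1}$ with $\eta^{p-1}(m_{k-1})\cdots\eta^0(m_{k-p})a_{k-p}\ne\eta^p(u_{-1})$ and $u_{-|\eta^k(u_{-1})|}\cdots u_{n-1}=\eta^{k-1}(m_{k-1})\cdots\eta^0(m_0)$. Define $\mathrm{rep}_u(n)=0\odot|m_{k-1}|\odot\cdots\odot|m_0|$ for $n\ge1$, $\mathrm{rep}_u(0)=0$, $\mathrm{rep}_u(-1)=1$, $\mathrm{rep}_u(n)=1\odot|m_{k-1}|\odot\cdots\odot|m_0|$ for $n\le-2$. The automaton $\mathcal{A}_{\eta,s}$ has state set $A\cup\{\mathtt{start}\}$, initial state $\mathtt{start}$, accepting states $A$, and partial transition function $\delta$ with $\delta(\mathtt{start},0)=u_0$, $\delta(\mathtt{start},1)=u_{-1}$, and for $c\in A$, $\delta(c,i)=\eta(c)[i]$ defined iff $0\le i<|\eta(c)|$; extended to words by $\delta(q,\varepsilon)=q$, $\delta(q,i\odot w)=\delta(\delta(q,i),w)$; $\mathcal{A}_{\eta,s}(w)=\delta(\mathtt{start},w)$. *)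

theory Defs
  imports Complex_Main "HOL-Library.Sublist"
begin

definition growing :: "('a list \<Rightarrow> 'a list) \<Rightarrow> 'a \<Rightarrow> bool" where
  "growing \<eta> a \<longleftrightarrow> filterlim (\<lambda>k. length ((\<eta> ^^ k) [a])) at_top at_top"

definition substitution :: "('a::finite list \<Rightarrow> 'a list) \<Rightarrow> bool" where
  "substitution \<eta> \<longleftrightarrow>
     (\<forall>v w. \<eta> (v @ w) = \<eta> v @ \<eta> w) \<and> (\<forall>a. \<eta> [a] \<noteq> []) \<and> (\<exists>a. growing \<eta> a)"

text \<open>
  The action of a substitution on a two-sided sequence. Since no letter is erased, the image of
  the factor between the origin and position n is long enough to contain the letter at position n
  of the image sequence; for negative n that letter is counted from the right end.
\<close>
definition subst_seq :: "('a list \<Rightarrow> 'a list) \<Rightarrow> (int \<Rightarrow> 'a) \<Rightarrow> (int \<Rightarrow> 'a)" where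
  "subst_seq \<eta> u n =
     (if 0 \<le> n then \<eta> (map u [0..n]) ! nat n
      else let w = \<eta> (map u [n..-1]) in w ! nat (int (length w) + n))"

definition periodic_point :: "('a list \<Rightarrow> 'a list) \<Rightarrow> (int \<Rightarrow> 'a) \<Rightarrow> bool" where
  "periodic_point \<eta> u \<longleftrightarrow> (\<exists>p\<ge>1. (subst_seq \<eta> ^^ p) u = u)"

definition period :: "('a list \<Rightarrow> 'a list) \<Rightarrow> (int \<Rightarrow> 'a) \<Rightarrow> nat" where
  "period \<eta> u = (LEAST p. 1 \<le> p \<and> (subst_seq \<eta> ^^ p) u = u)"

definition seed :: "(int \<Rightarrow> 'a) \<Rightarrow> 'a \<times> 'a" where
  "seed u = (u (-1), u 0)"

definition growing_seed :: "('a list \<Rightarrow> 'a list) \<Rightarrow> 'a \<times> 'a \<Rightarrow> bool" where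
  "growing_seed \<eta> s \<longleftrightarrow> growing \<eta> (fst s) \<and> growing \<eta> (snd s)"

text \<open>
  A sequence \<open>(m\<^sub>i, a\<^sub>i)\<close>, \<open>i = 0, \<dots>, k - 1\<close>, is the list of length k whose entry at index i is
  \<open>(m\<^sub>i, a\<^sub>i)\<close>. Admissible sequences are nonempty.
\<close>
definition admissible :: "('a list \<Rightarrow> 'a list) \<Rightarrow> 'a \<Rightarrow> ('a list \<times> 'a) list \<Rightarrow> bool" where
  "admissible \<eta> x ms \<longleftrightarrow>
     ms \<noteq> [] \<and>
     (\<forall>i. 1 \<le> i \<and> i < length ms \<longrightarrow>
        prefix (fst (ms ! (i - 1)) @ [snd (ms ! (i - 1))]) (\<eta> [snd (ms ! i)])) \<and>
     prefix (fst (last ms) @ [snd (last ms)]) (\<eta> [x])"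

text \<open>The word \<open>\<eta>\<^bsup>k-1\<^esup>(m\<^sub>k\<^sub>-\<^sub>1) \<cdots> \<eta>\<^sup>0(m\<^sub>0)\<close>.\<close>
definition expansion :: "('a list \<Rightarrow> 'a list) \<Rightarrow> ('a list \<times> 'a) list \<Rightarrow> 'a list" where
  "expansion \<eta> ms = concat (map (\<lambda>i. (\<eta> ^^ i) (fst (ms ! i))) (rev [0..<length ms]))"

text \<open>
  In both definitions below \<open>drop (k - p) ms\<close> is the block of the p entries with indices
  \<open>k - p, \<dots>, k - 1\<close>; admissibility and \<open>p dvd k\<close> give \<open>k \<ge> p\<close>.
\<close>
definition is_pos_decomp ::
    "('a list \<Rightarrow> 'a list) \<Rightarrow> (int \<Rightarrow> 'a) \<Rightarrow> int \<Rightarrow> ('a list \<times> 'a) list \<Rightarrow> bool" where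
  "is_pos_decomp \<eta> u n ms \<longleftrightarrow>
     (let p = period \<eta> u; k = length ms in
        p dvd k \<and>
        admissible \<eta> (u 0) ms \<and>
        concat (map fst (rev (drop (k - p) ms))) \<noteq> [] \<and>
        map u [0..n - 1] = expansion \<eta> ms)"

text \<open>
  The word \<open>u\<^bsub>-L\<^esub> \<cdots> u\<^bsub>n-1\<^esub>\<close> with \<open>L = |\<eta>\<^sup>k(u\<^bsub>-1\<^esub>)|\<close> is meaningful only if \<open>-L \<le> n\<close> (it is
  empty for \<open>-L = n\<close>). This is required explicitly, as \<open>[-L..n - 1]\<close> is also the empty list
  for \<open>-L > n\<close>.
\<close>
definition is_neg_decomp ::
    "('a list \<Rightarrow> 'a list) \<Rightarrow> (int \<Rightarrow> 'a) \<Rightarrow> int \<Rightarrow> ('a list \<times> 'a) list \<Rightarrow> bool" where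
  "is_neg_decomp \<eta> u n ms \<longleftrightarrow>
     (let p = period \<eta> u; k = length ms; L = int (length ((\<eta> ^^ k) [u (-1)])) in
        p dvd k \<and>
        admissible \<eta> (u (-1)) ms \<and>
        expansion \<eta> (drop (k - p) ms) @ [snd (ms ! (k - p))] \<noteq> (\<eta> ^^ p) [u (-1)] \<and>
        - L \<le> n \<and>
        map u [- L..n - 1] = expansion \<eta> ms)"

definition digits :: "('a list \<times> 'a) list \<Rightarrow> nat list" where
  "digits ms = rev (map (length \<circ> fst) ms)"

definition rep :: "('a list \<Rightarrow> 'a list) \<Rightarrow> (int \<Rightarrow> 'a) \<Rightarrow> int \<Rightarrow> nat list" where
  "rep \<eta> u n =
     (if n \<ge> 1 then 0 # digits (THE ms. is_pos_decomp \<eta> u n ms)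
      else if n = 0 then [0]
      else if n = -1 then [1]
      else 1 # digits (THE ms. is_neg_decomp \<eta> u n ms))"

record ('q, 'd) partial_dfa =
  states :: "'q set"
  alphabet :: "'d set"
  initial :: 'q
  accepting :: "'q set"
  delta :: "'q \<Rightarrow> 'd \<Rightarrow> 'q option"

fun run_from :: "('q, 'd) partial_dfa \<Rightarrow> 'q \<Rightarrow> 'd list \<Rightarrow> 'q option" where
  "run_from M q [] = Some q"
| "run_from M q (d # w) = Option.bind (delta M q d) (\<lambda>q'. run_from M q' w)"

definition run :: "('q, 'd) partial_dfa \<Rightarrow> 'd list \<Rightarrow> 'q option" where
  "run M w = run_from M (initial M) w"

datatype 'a state = Start | Letter 'a

fun subst_trans ::
    "('a list \<Rightarrow> 'a list) \<Rightarrow> 'a \<times> 'a \<Rightarrow> 'a state \<Rightarrow> nat \<Rightarrow> 'a state option" where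
  "subst_trans \<eta> s Start i =
     (if i = 0 then Some (Letter (snd s)) else if i = 1 then Some (Letter (fst s)) else None)"
| "subst_trans \<eta> s (Letter c) i =
     (if i < length (\<eta> [c]) then Some (Letter (\<eta> [c] ! i)) else None)"

definition subst_automaton ::
    "('a::finite list \<Rightarrow> 'a list) \<Rightarrow> 'a \<times> 'a \<Rightarrow> ('a state, nat) partial_dfa" where
  "subst_automaton \<eta> s =
     \<lparr> states = UNIV,
       alphabet = {..<Max (range (\<lambda>c. length (\<eta> [c])))},
       initial = Start,
       accepting = range Letter,
       delta = subst_trans \<eta> s \<rparr>"

end

theory Submission imports Defs begin

text \<open>
  Read from the top index down, an \<open>x\<close>-admissible sequence of length \<open>k\<close> is a path in the prefix
  automaton starting at \<open>x\<close>. Descending through the factorisations of \<open>\<eta>\<^sup>k(x)\<close> shows that such paths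
  correspond bijectively to the positions of \<open>\<eta>\<^sup>k(x)\<close>: the length of the expansion is the position,
  and the endpoint of the path, which is also the state reached by the automaton on the digits, is the
  letter found there. Since \<open>\<eta>\<^sup>p(u\<^sub>0)\<close> starts with \<open>u\<^sub>0\<close> and \<open>\<eta>\<^sup>p(u\<^bsub>-1\<^esub>)\<close> ends with \<open>u\<^bsub>-1\<^esub>\<close>, the condition
  on the top block of \<open>p\<close> entries says that the position does not already occur in
  \<open>\<eta>\<^bsup>k-p\<^esup>\<close> of the seed letter. As these lengths increase to infinity, \<open>k\<close> is determined by \<open>n\<close>.
\<close>

section \<open>Paths in the prefix automaton\<close>

fun path :: "('a list \<Rightarrow> 'a list) \<Rightarrow> 'a \<Rightarrow> ('a list \<times> 'a) list \<Rightarrow> bool" where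
  "path \<eta> x [] \<longleftrightarrow> True"
| "path \<eta> x ((m, a) # r) \<longleftrightarrow> prefix (m @ [a]) (\<eta> [x]) \<and> path \<eta> a r"

text \<open>With the top index first, the index of an entry is the number of entries after it; hence
  the exponent \<open>length r\<close>.\<close>

fun path_word :: "('a list \<Rightarrow> 'a list) \<Rightarrow> ('a list \<times> 'a) list \<Rightarrow> 'a list" where
  "path_word \<eta> [] = []"
| "path_word \<eta> ((m, a) # r) = (\<eta> ^^ length r) m @ path_word \<eta> r"

fun path_end :: "'a \<Rightarrow> ('a list \<times> 'a) list \<Rightarrow> 'a" where
  "path_end x [] = x"
| "path_end x ((m, a) # r) = path_end a r"

lemma path_append: "path \<eta> x (s @ t) \<longleftrightarrow> path \<eta> x s \<and> path \<eta> (path_end x s) t"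
  by (induction s arbitrary: x) auto

lemma path_end_eq: "path_end x r = (if r = [] then x else snd (last r))"
  by (induction r arbitrary: x) auto

lemma expansion_eq_path_word: "expansion \<eta> ms = path_word \<eta> (rev ms)"
proof (induction ms rule: rev_induct)
  case Nil
  show ?case by (simp add: expansion_def)
next
  case (snoc z ms)
  have "map (\<lambda>i. (\<eta> ^^ i) (fst ((ms @ [z]) ! i))) (rev [0..<length ms])
      = map (\<lambda>i. (\<eta> ^^ i) (fst (ms ! i))) (rev [0..<length ms])"
    by (auto simp: nth_append)
  then have "expansion \<eta> (ms @ [z]) = (\<eta> ^^ length ms) (fst z) @ expansion \<eta> ms"
    by (simp add: expansion_def del: map_eq_conv)
  then show ?case using snoc by (cases z) simp
qed

text \<open>Reversal puts the entry constrained by \<open>\<eta> [x]\<close> first; every later one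
  is constrained by the image of its predecessor's letter, which is the recursion of
  \<open>path\<close>.\<close>

lemma admissible_iff_path: "admissible \<eta> x ms \<longleftrightarrow> ms \<noteq> [] \<and> path \<eta> x (rev ms)"
proof (induction ms arbitrary: x rule: rev_induct)
  case Nil
  show ?case by (simp add: admissible_def)
next
  case (snoc z ms)
  obtain m a where z: "z = (m, a)" by (cases z)
  show ?case
  proof (cases "ms = []")
    case True
    then show ?thesis by (simp add: admissible_def z)
  next
    case False
    let ?P = "\<lambda>ms i. prefix (fst (ms ! (i - 1)) @ [snd (ms ! (i - 1))]) (\<eta> [snd (ms ! i)])"
    have len: "length ms \<ge> 1" using False by (cases ms) auto
    have "(\<forall>i. 1 \<le> i \<and> i < length (ms @ [z]) \<longrightarrow> ?P (ms @ [z]) i) \<longleftrightarrow>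
        (\<forall>i. 1 \<le> i \<and> i < length ms \<longrightarrow> ?P (ms @ [z]) i) \<and> ?P (ms @ [z]) (length ms)"
      using len by (auto simp: less_Suc_eq)
    also have "\<dots> \<longleftrightarrow> (\<forall>i. 1 \<le> i \<and> i < length ms \<longrightarrow> ?P ms i) \<and>
        prefix (fst (last ms) @ [snd (last ms)]) (\<eta> [a])"
      using len False by (auto simp: nth_append last_conv_nth z)
    finally have "admissible \<eta> x (ms @ [z]) \<longleftrightarrow> admissible \<eta> a ms \<and> prefix (m @ [a]) (\<eta> [x])"
      using False by (simp add: admissible_def z)
    then show ?thesis using snoc[of a] False by (auto simp: z)
  qed
qed

text \<open>Since \<open>m @ [a]\<close> is a prefix of \<open>\<eta> [x]\<close>, the letter of
  \<open>\<eta> [x]\<close> at index \<open>length m\<close> is \<open>a\<close>, so each digit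
  leads to the next letter of the path.\<close>

lemma run_from_digits:
  assumes "path \<eta> x r"
  shows "run_from (subst_automaton \<eta> s) (Letter x) (map (length \<circ> fst) r)
           = Some (Letter (path_end x r))"
  using assms
proof (induction r arbitrary: x)
  case Nil
  show ?case by simp
next
  case (Cons z r)
  obtain m a where z: "z = (m, a)" by (cases z)
  from Cons.prems obtain t where "\<eta> [x] = m @ a # t"
    by (auto simp: z prefix_def)
  with Cons show ?case by (simp add: z subst_automaton_def)
qed

text \<open>The index sought is the predecessor of the least \<open>q\<close> with
  \<open>N < f q\<close>. This serves both to find the block covering a position and to find the
  number of periods.\<close>

lemma ex1_nat_bracket:
  fixes f :: "nat \<Rightarrow> nat"
  assumes mono: "\<And>q. f q \<le> f (Suc q)" and start: "f 0 \<le> N" and unbounded: "\<exists>q. N < f q"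
  shows "\<exists>!q. f q \<le> N \<and> N < f (Suc q)"
proof -
  define Q where "Q = (LEAST q. N < f q)"
  have Q: "N < f Q" unfolding Q_def using unbounded by (rule LeastI_ex)
  have "Q \<noteq> 0" using Q start by (metis not_less)
  then obtain q where q: "Q = Suc q" by (cases Q) auto
  have "f q \<le> N" using not_less_Least[of q "\<lambda>q. N < f q"] q by (auto simp: Q_def)
  moreover have "q' = q''"
    if "f q' \<le> N" "N < f (Suc q')" "f q'' \<le> N" "N < f (Suc q'')" for q' q''
  proof -
    have "Suc i \<le> j \<Longrightarrow> f (Suc i) \<le> f j" for i j
      using mono by (rule lift_Suc_mono_le)
    then show ?thesis using that by (metis Suc_leI le_less_trans nat_neq_iff not_less)
  qed
  ultimately show ?thesis using Q q by blast
qed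

section \<open>One-sided sequences and reversal\<close>

definition seq_prefix :: "(nat \<Rightarrow> 'a) \<Rightarrow> nat \<Rightarrow> 'a list" where
  "seq_prefix v n = map v [0..<n]"

definition right_action :: "('a list \<Rightarrow> 'a list) \<Rightarrow> (nat \<Rightarrow> 'a) \<Rightarrow> nat \<Rightarrow> 'a" where
  "right_action \<eta> v i = \<eta> (seq_prefix v (Suc i)) ! i"

text \<open>Conjugation by reversal makes the left half, read away from the origin, a one-sided
  sequence, so that \<open>right_action\<close> treats both halves.\<close>

definition mirror :: "('a list \<Rightarrow> 'a list) \<Rightarrow> 'a list \<Rightarrow> 'a list" where
  "mirror \<eta> w = rev (\<eta> (rev w))"

lemma length_seq_prefix [simp]: "length (seq_prefix v n) = n"
  by (simp add: seq_prefix_def)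

lemma nth_seq_prefix [simp]: "i < n \<Longrightarrow> seq_prefix v n ! i = v i"
  by (simp add: seq_prefix_def)

lemma seq_prefix_Suc_0 [simp]: "seq_prefix v (Suc 0) = [v 0]"
  by (simp add: seq_prefix_def)

lemma seq_prefix_add: "seq_prefix v (m + n) = seq_prefix v m @ map v [m..<m + n]"
  unfolding seq_prefix_def by (metis add.left_neutral map_append upt_add_eq_append zero_le)

lemma seq_prefix_of_int: "seq_prefix (\<lambda>i. u (int i)) n = map u [0..int n - 1]"
  by (rule nth_equalityI) auto

lemma rev_seq_prefix_negative:
  "rev (seq_prefix (\<lambda>i. u (- 1 - int i)) n) = map u [- int n..- 1]"
  by (rule nth_equalityI) (auto simp: rev_nth of_nat_diff algebra_simps)

lemma funpow_mirror: "(mirror \<eta> ^^ k) w = rev ((\<eta> ^^ k) (rev w))"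
  by (induction k arbitrary: w) (auto simp: mirror_def)

section \<open>Iterates of a nonerasing morphism\<close>

locale nonerasing_morphism =
  fixes \<eta> :: "'a list \<Rightarrow> 'a list"
  assumes morphism: "\<eta> (v @ w) = \<eta> v @ \<eta> w"
    and nonerasing: "\<eta> [a] \<noteq> []"
begin

lemma morphism_Nil [simp]: "\<eta> [] = []"
  using morphism[of "[]" "[]"] by simp

lemma length_le: "length w \<le> length (\<eta> w)"
proof (induction w)
  case (Cons a w)
  have "length (\<eta> (a # w)) = length (\<eta> [a]) + length (\<eta> w)"
    using morphism[of "[a]" w] by simp
  moreover have "length (\<eta> [a]) \<ge> 1" using nonerasing[of a] by (cases "\<eta> [a]") auto
  ultimately show ?case using Cons by simp
qed simp

lemma funpow_append: "(\<eta> ^^ k) (v @ w) = (\<eta> ^^ k) v @ (\<eta> ^^ k) w"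
  by (induction k) (auto simp: morphism)

lemma funpow_Nil [simp]: "(\<eta> ^^ k) [] = []"
  by (induction k) auto

lemma length_funpow_le: "length w \<le> length ((\<eta> ^^ k) w)"
  by (induction k) (auto intro: order_trans[OF _ length_le])

lemma funpow_prefix: "prefix v w \<Longrightarrow> prefix ((\<eta> ^^ k) v) ((\<eta> ^^ k) w)"
  by (auto simp: prefix_def funpow_append)

lemma length_funpow_mono: "k \<le> l \<Longrightarrow> length ((\<eta> ^^ k) w) \<le> length ((\<eta> ^^ l) w)"
  using length_funpow_le[of "(\<eta> ^^ k) w" "l - k"]
  by (metis add.commute comp_apply funpow_add le_add_diff_inverse)

lemma funpow_eq_Nil_iff: "(\<eta> ^^ k) w = [] \<longleftrightarrow> w = []"
  using length_funpow_le[of w k] by auto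

section \<open>Paths and positions in iterated images\<close>

lemma path_word_append:
  "path_word \<eta> (s @ t) = (\<eta> ^^ length t) (path_word \<eta> s) @ path_word \<eta> t"
proof (induction s)
  case (Cons z s)
  \<comment> \<open>Appending \<open>t\<close> puts \<open>length t\<close> further entries after
    each entry of \<open>s\<close>, which raises its exponent by that amount.\<close>
  have "(\<eta> ^^ length (s @ t)) m = (\<eta> ^^ length t) ((\<eta> ^^ length s) m)" for m
    by (metis add.commute comp_apply funpow_add length_append)
  with Cons show ?case by (cases z) (simp add: funpow_append)
qed simp

lemma path_word_eq_Nil_iff: "path_word \<eta> r = [] \<longleftrightarrow> concat (map fst r) = []"
  by (induction r) (auto simp: funpow_eq_Nil_iff)

text \<open>The iterate maps \<open>m @ [a]\<close> to the image of \<open>m\<close> followed by the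
  block of \<open>a\<close>; by induction the rest of the path locates its endpoint inside this
  block.\<close>

lemma prefix_path_word_path_end:
  "path \<eta> x r \<Longrightarrow> prefix (path_word \<eta> r @ [path_end x r]) ((\<eta> ^^ length r) [x])"
proof (induction r arbitrary: x)
  case (Cons z r)
  obtain m a where z: "z = (m, a)" by (cases z)
  from Cons.prems have "prefix ((\<eta> ^^ length r) (m @ [a])) ((\<eta> ^^ length r) (\<eta> [x]))"
    by (intro funpow_prefix) (simp add: z)
  moreover have "prefix (path_word \<eta> r @ [path_end a r]) ((\<eta> ^^ length r) [a])"
    using Cons by (simp add: z)
  ultimately show ?case
    by (simp add: z funpow_append funpow_swap1)
      (meson prefix_order.trans same_prefix_prefix)
qed simp

lemma length_path_word_less:
  "path \<eta> x r \<Longrightarrow> length (path_word \<eta> r) < length ((\<eta> ^^ length r) [x])"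
  using prefix_length_le[OF prefix_path_word_path_end, of x r] by simp

lemma path_end_nth:
  "path \<eta> x r \<Longrightarrow> path_end x r = (\<eta> ^^ length r) [x] ! length (path_word \<eta> r)"
  using prefix_path_word_path_end[of x r] by (auto simp: prefix_def nth_append)

lemma take_path_word:
  "path \<eta> x r \<Longrightarrow> take (length (path_word \<eta> r)) ((\<eta> ^^ length r) [x]) = path_word \<eta> r"
  using prefix_path_word_path_end[of x r] by (auto simp: prefix_def)

text \<open>The lengths of the images of the prefixes of \<open>w\<close> increase weakly beyond
  \<open>j\<close>; the bracket around \<open>j\<close> singles out the letter whose block covers
  \<open>j\<close>.\<close>

lemma obtain_prefix_at_position:
  assumes "j < length ((\<eta> ^^ k) w)"
  obtains m a where "prefix (m @ [a]) w" "length ((\<eta> ^^ k) m) \<le> j" "j < length ((\<eta> ^^ k) (m @ [a]))"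
    and "\<And>m' a'. prefix (m' @ [a']) w \<Longrightarrow> length ((\<eta> ^^ k) m') \<le> j
           \<Longrightarrow> j < length ((\<eta> ^^ k) (m' @ [a'])) \<Longrightarrow> m' = m \<and> a' = a"
proof -
  let ?f = "\<lambda>i. length ((\<eta> ^^ k) (take i w))"
  have mono: "?f i \<le> ?f (Suc i)" for i
    by (intro prefix_length_le funpow_prefix) (metis Suc_eq_plus1 prefixI take_add)
  have "\<exists>i. j < ?f i" using assms by (intro exI[of _ "length w"]) simp
  then have ex1: "\<exists>!i. ?f i \<le> j \<and> j < ?f (Suc i)"
    by (intro ex1_nat_bracket mono) auto
  then obtain i where i: "?f i \<le> j" "j < ?f (Suc i)" by blast
  \<comment> \<open>Past the end of \<open>w\<close> two successive prefixes coincide, and the two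
    bounds would contradict each other.\<close>
  have "i < length w" using i by (metis leI le_SucI not_less take_all)
  then have take: "take (Suc i) w = take i w @ [w ! i]" by (rule take_Suc_conv_app_nth)
  show thesis
  proof (rule that)
    show "prefix (take i w @ [w ! i]) w" "length ((\<eta> ^^ k) (take i w)) \<le> j"
      "j < length ((\<eta> ^^ k) (take i w @ [w ! i]))"
      using i by (simp_all add: take[symmetric] take_is_prefix)
  next
    fix m a
    assume ma: "prefix (m @ [a]) w" "length ((\<eta> ^^ k) m) \<le> j" "j < length ((\<eta> ^^ k) (m @ [a]))"
    then obtain t where w: "w = m @ a # t" by (auto simp: prefix_def)
    have "?f (length m) \<le> j" "j < ?f (Suc (length m))" using ma by (simp_all add: w)
    with ex1 i have "length m = i" by blast
    then show "m = take i w \<and> a = w ! i" by (auto simp: w)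
  qed
qed

text \<open>Position \<open>j\<close> of \<open>(\<eta> ^^ k) (\<eta> [x])\<close> lies in the block
  of exactly one letter of \<open>\<eta> [x]\<close>. That letter and the word before it form the
  first entry; the offset inside the block determines the rest by induction.\<close>

lemma ex1_path:
  assumes "j < length ((\<eta> ^^ k) [x])"
  shows "\<exists>!r. length r = k \<and> path \<eta> x r \<and> length (path_word \<eta> r) = j"
  using assms
proof (induction k arbitrary: x j)
  case 0
  then show ?case by (intro ex1I[of _ "[]"]) auto
next
  case (Suc k)
  let ?g = "\<lambda>w. length ((\<eta> ^^ k) w)"
  have "j < ?g (\<eta> [x])" using Suc.prems by (simp add: funpow_swap1)
  from obtain_prefix_at_position[OF this]
  obtain m a where ma: "prefix (m @ [a]) (\<eta> [x])" "?g m \<le> j" "j < ?g (m @ [a])"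
    and ma_unique: "\<And>m' a'. prefix (m' @ [a']) (\<eta> [x]) \<Longrightarrow> ?g m' \<le> j \<Longrightarrow> j < ?g (m' @ [a'])
            \<Longrightarrow> m' = m \<and> a' = a"
    by metis
  have "j - ?g m < ?g [a]" using ma by (simp add: funpow_append)
  from Suc.IH[OF this] obtain r where r: "length r = k" "path \<eta> a r" "length (path_word \<eta> r) = j - ?g m"
    and r_unique: "\<And>r'. length r' = k \<Longrightarrow> path \<eta> a r' \<Longrightarrow> length (path_word \<eta> r') = j - ?g m \<Longrightarrow> r' = r"
    by (elim ex1E) blast
  show ?case
  proof (rule ex1I[of _ "(m, a) # r"])
    show "length ((m, a) # r) = Suc k \<and> path \<eta> x ((m, a) # r) \<and> length (path_word \<eta> ((m, a) # r)) = j"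
      using r ma by simp
  next
    fix s
    assume s: "length s = Suc k \<and> path \<eta> x s \<and> length (path_word \<eta> s) = j"
    then obtain m' a' r' where s': "s = (m', a') # r'" by (cases s) auto
    have len: "length r' = k" and r': "path \<eta> a' r'" and j: "?g m' + length (path_word \<eta> r') = j"
      and pre: "prefix (m' @ [a']) (\<eta> [x])"
      using s by (auto simp: s')
    \<comment> \<open>The rest of the path stays inside the block of \<open>a'\<close>, so this
      block covers \<open>j\<close> and must be the one chosen.\<close>
    have "length (path_word \<eta> r') < ?g [a']" using length_path_word_less[OF r'] len by simp
    then have "m' = m \<and> a' = a" using j pre by (intro ma_unique) (auto simp: funpow_append)
    with len r' j show "s = (m, a) # r" by (auto simp: s' intro: r_unique)
  qed
qed

text \<open>If the top block is empty, it leads back to \<open>x\<close> and the position stays in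
  the leading block of \<open>x\<close>. Otherwise its word begins with \<open>x\<close>, and the
  position is at or past the end of that leading block.\<close>

lemma path_word_take_eq_Nil_iff:
  assumes r: "path \<eta> x r" and p: "p \<le> length r" and start: "(\<eta> ^^ p) [x] = x # w"
  shows "concat (map fst (take p r)) = [] \<longleftrightarrow>
           length (path_word \<eta> r) < length ((\<eta> ^^ (length r - p)) [x])"
proof -
  define s t where "s = take p r" and "t = drop p r"
  have st: "r = s @ t" "length s = p" "length t = length r - p" using p by (auto simp: s_def t_def)
  have s: "path \<eta> x s" and t: "path \<eta> (path_end x s) t" using r by (auto simp: st(1) path_append)
  have pre: "prefix (path_word \<eta> s @ [path_end x s]) (x # w)"
    using prefix_path_word_path_end[OF s] by (simp add: st start)
  have word: "path_word \<eta> r = (\<eta> ^^ length t) (path_word \<eta> s) @ path_word \<eta> t"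
    by (simp add: st(1) path_word_append)
  show ?thesis
  proof (cases "path_word \<eta> s")
    case Nil
    then have "path_end x s = x" using pre by simp
    then show ?thesis
      using Nil length_path_word_less[OF t] word path_word_eq_Nil_iff[of s]
      by (simp add: st(3)[symmetric] s_def[symmetric])
  next
    case (Cons b v)
    then have "prefix [x] (path_word \<eta> s)" using pre by simp
    then have "length ((\<eta> ^^ length t) [x]) \<le> length ((\<eta> ^^ length t) (path_word \<eta> s))"
      by (intro prefix_length_le funpow_prefix)
    then show ?thesis
      using Cons word path_word_eq_Nil_iff[of s]
      by (simp add: st(3)[symmetric] s_def[symmetric])
  qed
qed

text \<open>Equality means that the top entries select the final \<open>x\<close>, which places the
  position in the last block. Any other choice selects a letter of \<open>w\<close>, whose image
  lies entirely before that block.\<close>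

lemma path_word_take_last_iff:
  assumes r: "path \<eta> x r" and p: "p \<le> length r" and stop: "(\<eta> ^^ p) [x] = w @ [x]"
  shows "path_word \<eta> (take p r) @ [path_end x (take p r)] \<noteq> (\<eta> ^^ p) [x] \<longleftrightarrow>
           length (path_word \<eta> r) + length ((\<eta> ^^ (length r - p)) [x]) < length ((\<eta> ^^ length r) [x])"
proof -
  define s t where "s = take p r" and "t = drop p r"
  have st: "r = s @ t" "length s = p" "length t = length r - p" using p by (auto simp: s_def t_def)
  have s: "path \<eta> x s" and t: "path \<eta> (path_end x s) t" using r by (auto simp: st(1) path_append)
  have pre: "prefix (path_word \<eta> s @ [path_end x s]) (w @ [x])"
    using prefix_path_word_path_end[OF s] by (simp add: st stop)
  have word: "path_word \<eta> r = (\<eta> ^^ length t) (path_word \<eta> s) @ path_word \<eta> t"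
    by (simp add: st(1) path_word_append)
  have "(\<eta> ^^ length r) [x] = (\<eta> ^^ length t) ((\<eta> ^^ p) [x])"
    using p by (simp add: st(3) funpow_add[symmetric, THEN fun_cong, simplified comp_def])
  then have total: "length ((\<eta> ^^ length r) [x])
      = length ((\<eta> ^^ length t) w) + length ((\<eta> ^^ length t) [x])"
    by (simp add: stop funpow_append)
  show ?thesis
  proof (cases "path_word \<eta> s @ [path_end x s] = w @ [x]")
    case True
    then show ?thesis using word total
      by (simp add: stop st(3)[symmetric] s_def[symmetric])
  next
    case False
    then have "prefix (path_word \<eta> s @ [path_end x s]) w" using pre by auto
    then have "length ((\<eta> ^^ length t) (path_word \<eta> s @ [path_end x s])) \<le> length ((\<eta> ^^ length t) w)"
      by (intro prefix_length_le funpow_prefix)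
    then show ?thesis using False word total length_path_word_less[OF t]
      by (simp add: stop st(3)[symmetric] s_def[symmetric] funpow_append)
  qed
qed

section \<open>The one-sided action on prefixes\<close>

lemma image_seq_prefix:
  "seq_prefix (right_action \<eta> v) (length (\<eta> (seq_prefix v n))) = \<eta> (seq_prefix v n)"
proof (rule nth_equalityI)
  fix i assume "i < length (seq_prefix (right_action \<eta> v) (length (\<eta> (seq_prefix v n))))"
  then have i: "i < length (\<eta> (seq_prefix v n))" by simp
  have i': "i < length (\<eta> (seq_prefix v (Suc i)))"
    using length_le[of "seq_prefix v (Suc i)"] by simp
  \<comment> \<open>Lengthening a prefix only extends its image. The images of \<open>n\<close> and
    of \<open>Suc i\<close> letters are therefore compared through that of \<open>n + Suc i\<close>
    letters.\<close>
  have cmp: "\<eta> (seq_prefix v (m + l)) ! i = \<eta> (seq_prefix v m) ! i"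
    if "i < length (\<eta> (seq_prefix v m))" for m l
    using that by (simp add: seq_prefix_add morphism nth_append)
  have "\<eta> (seq_prefix v n) ! i = \<eta> (seq_prefix v (Suc i)) ! i"
    using cmp[OF i, of "Suc i"] cmp[OF i', of n] by (simp add: add.commute)
  then show "seq_prefix (right_action \<eta> v) (length (\<eta> (seq_prefix v n))) ! i
      = \<eta> (seq_prefix v n) ! i"
    using i by (simp add: right_action_def)
qed simp

lemma funpow_seq_prefix:
  "seq_prefix ((right_action \<eta> ^^ k) v) (length ((\<eta> ^^ k) (seq_prefix v n)))
     = (\<eta> ^^ k) (seq_prefix v n)"
proof (induction k)
  case (Suc k)
  show ?case
    using Suc image_seq_prefix[of "(right_action \<eta> ^^ k) v" "length ((\<eta> ^^ k) (seq_prefix v n))"]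
    by simp
qed simp

text \<open>This covers both signs: \<open>N\<close> is the distance from the origin, counted from 0
  in either half, and \<open>j q\<close> the matching index from the left in the iterate
  \<open>p * Suc q\<close>. Growth and the bracket fix \<open>q\<close>, then
  \<open>ex1_path\<close> fixes the sequence.\<close>

lemma ex1_admissible:
  assumes x: "growing \<eta> x" and p: "1 \<le> p" and N: "1 \<le> N"
    and j: "\<And>q. N < length ((\<eta> ^^ (p * Suc q)) [x]) \<Longrightarrow> j q < length ((\<eta> ^^ (p * Suc q)) [x])"
  shows "\<exists>!ms. \<exists>q. length ms = p * Suc q \<and> path \<eta> x (rev ms) \<and> length (path_word \<eta> (rev ms)) = j q
           \<and> length ((\<eta> ^^ (p * q)) [x]) \<le> N \<and> N < length ((\<eta> ^^ (p * Suc q)) [x])"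
    (is "\<exists>!ms. \<exists>q. ?P ms q")
proof -
  let ?f = "\<lambda>q. length ((\<eta> ^^ (p * q)) [x])"
  have "\<forall>\<^sub>F k in at_top. Suc N \<le> length ((\<eta> ^^ k) [x])"
    using x unfolding growing_def filterlim_at_top by blast
  then obtain K where K: "\<And>k. k \<ge> K \<Longrightarrow> Suc N \<le> length ((\<eta> ^^ k) [x])"
    by (auto simp: eventually_at_top_linorder)
  have "p * K \<ge> K" using p by (cases p) auto
  then have "N < ?f K" using K by (simp add: Suc_le_eq)
  \<comment> \<open>The brackets start at \<open>?f 0 = 1\<close>, the length of a single letter;
    hence the bound \<open>1 \<le> N\<close>.\<close>
  then have "\<exists>!q. ?f q \<le> N \<and> N < ?f (Suc q)"
    using N by (intro ex1_nat_bracket length_funpow_mono) auto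
  then obtain q where q: "?f q \<le> N" "N < ?f (Suc q)"
    and q_unique: "\<And>q'. ?f q' \<le> N \<Longrightarrow> N < ?f (Suc q') \<Longrightarrow> q' = q" by (elim ex1E) blast
  obtain r where r: "length r = p * Suc q" "path \<eta> x r" "length (path_word \<eta> r) = j q"
    and r_unique: "\<And>r'. length r' = p * Suc q \<Longrightarrow> path \<eta> x r' \<Longrightarrow> length (path_word \<eta> r') = j q \<Longrightarrow> r' = r"
    using ex1_path[OF j[OF q(2)]] by (elim ex1E) blast
  show ?thesis
  proof (rule ex1I[of _ "rev r"])
    show "\<exists>q. ?P (rev r) q" using r q by (intro exI[of _ q]) simp
  next
    fix ms assume "\<exists>q. ?P ms q"
    then obtain q' where q': "?P ms q'" by blast
    then have "q' = q" using q_unique by blast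
    then have "rev ms = r" using q' by (intro r_unique) auto
    then show "ms = rev r" by auto
  qed
qed

end

section \<open>The two halves of a two-sided sequence\<close>

lemma nonerasing_morphism_mirror:
  "nonerasing_morphism \<eta> \<Longrightarrow> nonerasing_morphism (mirror \<eta>)"
  by (simp add: nonerasing_morphism_def mirror_def)

lemma right_action_right_half:
  "(\<lambda>i. subst_seq \<eta> u (int i)) = right_action \<eta> (\<lambda>i. u (int i))"
  by (rule ext) (simp add: subst_seq_def right_action_def seq_prefix_of_int)

text \<open>For negative positions \<open>subst_seq\<close> counts from the right end of the image
  word, so position \<open>- 1 - int i\<close> is index \<open>i\<close> of the reversed
  word.\<close>

lemma right_action_left_half:
  assumes "nonerasing_morphism \<eta>"
  shows "(\<lambda>i. subst_seq \<eta> u (- 1 - int i)) = right_action (mirror \<eta>) (\<lambda>i. u (- 1 - int i))"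
proof
  fix i
  interpret nonerasing_morphism \<eta> by fact
  define w where "w = \<eta> (map u [- 1 - int i..- 1])"
  have len: "length w > i" using length_le[of "map u [- 1 - int i..- 1]"] by (simp add: w_def)
  have "right_action (mirror \<eta>) (\<lambda>i. u (- 1 - int i)) i = rev w ! i"
    using rev_seq_prefix_negative[of u "Suc i"]
    by (simp add: right_action_def mirror_def w_def algebra_simps)
  moreover have "subst_seq \<eta> u (- 1 - int i) = w ! nat (int (length w) + (- 1 - int i))"
    by (simp add: subst_seq_def w_def Let_def)
  moreover have "nat (int (length w) + (- 1 - int i)) = length w - Suc i" using len by simp
  ultimately show "subst_seq \<eta> u (- 1 - int i) = right_action (mirror \<eta>) (\<lambda>i. u (- 1 - int i)) i"
    using len by (simp add: rev_nth)
qed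

lemma funpow_right_half:
  "(\<lambda>i. (subst_seq \<eta> ^^ k) u (int i)) = (right_action \<eta> ^^ k) (\<lambda>i. u (int i))"
  by (induction k) (simp_all add: right_action_right_half)

lemma funpow_left_half:
  "nonerasing_morphism \<eta> \<Longrightarrow>
   (\<lambda>i. (subst_seq \<eta> ^^ k) u (- 1 - int i)) = (right_action (mirror \<eta>) ^^ k) (\<lambda>i. u (- 1 - int i))"
  by (induction k) (simp_all add: right_action_left_half)

section \<open>Periodic points with growing seed\<close>

locale growing_periodic_point = nonerasing_morphism \<eta>
  for \<eta> :: "'a list \<Rightarrow> 'a list" +
  fixes u :: "int \<Rightarrow> 'a"
  assumes periodic: "periodic_point \<eta> u"
    and growing_right: "growing \<eta> (u 0)"
    and growing_left: "growing \<eta> (u (- 1))"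
begin

abbreviation p where "p \<equiv> period \<eta> u"

lemma period: "1 \<le> p" "(subst_seq \<eta> ^^ p) u = u"
  using LeastI_ex[of "\<lambda>p. 1 \<le> p \<and> (subst_seq \<eta> ^^ p) u = u"] periodic
  by (auto simp: periodic_point_def period_def)

lemma funpow_period_mult: "(subst_seq \<eta> ^^ (p * q)) u = u"
proof (induction q)
  case (Suc q)
  then show ?case using period(2) by (simp add: funpow_add)
qed simp

text \<open>The action iterated \<open>p * q\<close> times fixes \<open>u\<close>, so the image of
  the one-letter prefix \<open>[u 0]\<close> is again a prefix of the right half.\<close>

lemma right_image:
  "map u [0..int (length ((\<eta> ^^ (p * q)) [u 0])) - 1] = (\<eta> ^^ (p * q)) [u 0]"
  using funpow_seq_prefix[of "p * q" "\<lambda>i. u (int i)" "Suc 0"]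
    funpow_right_half[where k = "p * q" and u = u and \<eta> = \<eta>]
  by (simp add: funpow_period_mult seq_prefix_of_int[symmetric])

text \<open>The same argument applied to \<open>mirror \<eta>\<close> and the left half, then
  reversed back.\<close>

lemma left_image:
  "map u [- int (length ((\<eta> ^^ (p * q)) [u (- 1)]))..- 1] = (\<eta> ^^ (p * q)) [u (- 1)]"
proof -
  interpret mir: nonerasing_morphism "mirror \<eta>"
    using nonerasing_morphism_axioms by (rule nonerasing_morphism_mirror)
  have "seq_prefix (\<lambda>i. u (- 1 - int i)) (length ((\<eta> ^^ (p * q)) [u (- 1)]))
      = rev ((\<eta> ^^ (p * q)) [u (- 1)])"
    using mir.funpow_seq_prefix[of "p * q" "\<lambda>i. u (- 1 - int i)" "Suc 0"]
      funpow_left_half[OF nonerasing_morphism_axioms, where k = "p * q" and u = u]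
    by (simp add: funpow_period_mult funpow_mirror)
  then show ?thesis
    by (simp add: rev_seq_prefix_negative[symmetric])
qed

lemma right_start: obtains w where "(\<eta> ^^ p) [u 0] = u 0 # w"
proof -
  have "length ((\<eta> ^^ p) [u 0]) \<ge> 1" using length_funpow_le[of "[u 0]" p] by simp
  then show thesis
    using right_image[of 1, symmetric] that by (subst (asm) upto_rec1) auto
qed

lemma left_stop: obtains w where "(\<eta> ^^ p) [u (- 1)] = w @ [u (- 1)]"
proof -
  have "length ((\<eta> ^^ p) [u (- 1)]) \<ge> 1" using length_funpow_le[of "[u (- 1)]" p] by simp
  then show thesis
    using left_image[of 1, symmetric] that by (subst (asm) upto_rec2) auto
qed

section \<open>Decompositions described by lengths\<close>

lemma multiple_of_period:
  assumes "p dvd length ms" "ms \<noteq> []"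
  obtains q where "length ms = p * Suc q"
proof -
  obtain c where c: "length ms = p * c" using assms(1) by (elim dvdE)
  then have "c \<noteq> 0" using assms(2) by (cases c) auto
  then show thesis using that c by (cases c) auto
qed

text \<open>The expansion of a path is a prefix of the right half, so equality of words reduces to
  equality of lengths. Removing the top block leaves \<open>p * q\<close> entries, whence the lower
  bound; the upper one comes from \<open>length_path_word_less\<close>.\<close>

lemma is_pos_decomp_iff:
  assumes n: "n \<ge> 1"
  shows "is_pos_decomp \<eta> u n ms \<longleftrightarrow>
    (\<exists>q. length ms = p * Suc q \<and> path \<eta> (u 0) (rev ms) \<and> length (path_word \<eta> (rev ms)) = nat n
       \<and> length ((\<eta> ^^ (p * q)) [u 0]) \<le> nat n \<and> nat n < length ((\<eta> ^^ (p * Suc q)) [u 0]))"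
    (is "_ \<longleftrightarrow> (\<exists>q. ?Q q)")
proof -
  have equiv: "is_pos_decomp \<eta> u n ms \<longleftrightarrow> ?Q q" if q: "length ms = p * Suc q" for q
  proof (cases "path \<eta> (u 0) (rev ms)")
    case False
    then show ?thesis by (simp add: is_pos_decomp_def admissible_iff_path Let_def)
  next
    case True
    have ne: "ms \<noteq> []" using q period(1) by auto
    obtain w where w: "(\<eta> ^^ p) [u 0] = u 0 # w" by (rule right_start)
    let ?L = "length ((\<eta> ^^ (p * Suc q)) [u 0])" and ?l = "length (path_word \<eta> (rev ms))"
    have less: "?l < ?L" using length_path_word_less[OF True] q by simp
    have "path_word \<eta> (rev ms) = take ?l (map u [0..int ?L - 1])"
      using take_path_word[OF True] q by (simp only: right_image length_rev)
    also have "\<dots> = map u [0..int ?l - 1]"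
      using less by (intro nth_equalityI) auto
    finally have "map u [0..n - 1] = path_word \<eta> (rev ms) \<longleftrightarrow> map u [0..n - 1] = map u [0..int ?l - 1]"
      by simp
    also have "\<dots> \<longleftrightarrow> ?l = nat n"
    proof
      assume "map u [0..n - 1] = map u [0..int ?l - 1]"
      then have "length (map u [0..n - 1]) = length (map u [0..int ?l - 1])" by simp
      then show "?l = nat n" by simp
    qed (use n in simp)
    finally have word: "map u [0..n - 1] = expansion \<eta> ms \<longleftrightarrow> ?l = nat n"
      by (simp add: expansion_eq_path_word)
    have "concat (map fst (take p (rev ms))) = [] \<longleftrightarrow> ?l < length ((\<eta> ^^ (length ms - p)) [u 0])"
      using path_word_take_eq_Nil_iff[OF True _ w] q by simp
    moreover have "rev (drop (length ms - p) ms) = take p (rev ms)"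
      using q by (simp add: take_rev)
    moreover have "length ms - p = p * q" using q by simp
    ultimately have top: "concat (map fst (rev (drop (length ms - p) ms))) \<noteq> [] \<longleftrightarrow>
        length ((\<eta> ^^ (p * q)) [u 0]) \<le> ?l"
      by (simp add: not_less)
    show ?thesis
      using True ne q word top less
      unfolding is_pos_decomp_def admissible_iff_path Let_def by auto
  qed
  have "\<exists>q. length ms = p * Suc q" if "is_pos_decomp \<eta> u n ms"
    using that multiple_of_period[of ms]
    unfolding is_pos_decomp_def admissible_iff_path Let_def by blast
  then show ?thesis using equiv by blast
qed

text \<open>The image of \<open>u (- 1)\<close> occupies the positions from \<open>-L\<close> to
  \<open>-1\<close>, so index \<open>L + n\<close> in it is position \<open>n\<close>, at distance
  \<open>- n - 1\<close> from its last letter.\<close>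

lemma is_neg_decomp_iff:
  assumes n: "n \<le> - 2"
  shows "is_neg_decomp \<eta> u n ms \<longleftrightarrow>
    (\<exists>q. length ms = p * Suc q \<and> path \<eta> (u (- 1)) (rev ms)
       \<and> length (path_word \<eta> (rev ms)) = nat (int (length ((\<eta> ^^ (p * Suc q)) [u (- 1)])) + n)
       \<and> length ((\<eta> ^^ (p * q)) [u (- 1)]) \<le> nat (- n - 1)
       \<and> nat (- n - 1) < length ((\<eta> ^^ (p * Suc q)) [u (- 1)]))"
    (is "_ \<longleftrightarrow> (\<exists>q. ?Q q)")
proof -
  have equiv: "is_neg_decomp \<eta> u n ms \<longleftrightarrow> ?Q q" if q: "length ms = p * Suc q" for q
  proof (cases "path \<eta> (u (- 1)) (rev ms)")
    case False
    then show ?thesis by (simp add: is_neg_decomp_def admissible_iff_path Let_def)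
  next
    case True
    have ne: "ms \<noteq> []" using q period(1) by auto
    obtain w where w: "(\<eta> ^^ p) [u (- 1)] = w @ [u (- 1)]" by (rule left_stop)
    let ?L = "length ((\<eta> ^^ (p * Suc q)) [u (- 1)])" and ?l = "length (path_word \<eta> (rev ms))"
    have less: "?l < ?L" using length_path_word_less[OF True] q by simp
    have "path_word \<eta> (rev ms) = take ?l (map u [- int ?L..- 1])"
      using take_path_word[OF True] q by (simp only: left_image length_rev)
    also have "\<dots> = map u [- int ?L..int ?l - int ?L - 1]"
      using less by (intro nth_equalityI) auto
    finally have eq: "path_word \<eta> (rev ms) = map u [- int ?L..int ?l - int ?L - 1]" .
    have word: "map u [- int ?L..n - 1] = expansion \<eta> ms \<longleftrightarrow> ?l = nat (int ?L + n)"
      if L: "- int ?L \<le> n"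
    proof
      assume "map u [- int ?L..n - 1] = expansion \<eta> ms"
      then have "length (map u [- int ?L..n - 1]) = ?l"
        by (metis expansion_eq_path_word)
      then show "?l = nat (int ?L + n)" by (simp add: add.commute)
    next
      assume "?l = nat (int ?L + n)"
      then have "int ?l - int ?L - 1 = n - 1" using L by simp
      then show "map u [- int ?L..n - 1] = expansion \<eta> ms"
        using eq by (simp add: expansion_eq_path_word)
    qed
    have rev: "rev (drop (length ms - p) ms) = take p (rev ms)"
      using q by (simp add: take_rev)
    \<comment> \<open>Read downwards, the nonempty top block ends with the entry of index
      \<open>length ms - p\<close>, whose letter is thus its endpoint.\<close>
    have "drop (length ms - p) ms \<noteq> []" "take p (rev ms) \<noteq> []"
      using q period(1) ne by auto
    then have "path_end (u (- 1)) (take p (rev ms)) = snd (ms ! (length ms - p))"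
      by (simp add: path_end_eq rev[symmetric] last_rev hd_drop_conv_nth)
    moreover have "length ms - p = p * q" using q by simp
    ultimately have top: "expansion \<eta> (drop (length ms - p) ms) @ [snd (ms ! (length ms - p))]
          \<noteq> (\<eta> ^^ p) [u (- 1)] \<longleftrightarrow> ?l + length ((\<eta> ^^ (p * q)) [u (- 1)]) < ?L"
      using path_word_take_last_iff[OF True _ w] q rev by (simp add: expansion_eq_path_word)
    have "is_neg_decomp \<eta> u n ms \<longleftrightarrow> ?l + length ((\<eta> ^^ (p * q)) [u (- 1)]) < ?L
        \<and> - int ?L \<le> n \<and> ?l = nat (int ?L + n)"
      unfolding is_neg_decomp_def admissible_iff_path Let_def top
      using True ne q word by auto
    \<comment> \<open>With \<open>?l = L + n\<close>, the strict bound says that the shorter image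
      has length less than \<open>- n\<close>, that is, at most \<open>- n - 1\<close>; likewise
      \<open>- L \<le> n\<close> is \<open>- n - 1 < L\<close>.\<close>
    also have "\<dots> \<longleftrightarrow> ?Q q"
      using True q n by auto
    finally show ?thesis .
  qed
  have "\<exists>q. length ms = p * Suc q" if "is_neg_decomp \<eta> u n ms"
    using that multiple_of_period[of ms]
    unfolding is_neg_decomp_def admissible_iff_path Let_def by blast
  then show ?thesis using equiv by blast
qed

section \<open>Unique decompositions and their endpoints\<close>

lemma ex1_pos_decomp:
  assumes n: "n \<ge> 1"
  shows "\<exists>!ms. is_pos_decomp \<eta> u n ms"
  unfolding is_pos_decomp_iff[OF n]
  using n by (intro ex1_admissible growing_right period(1)) auto

lemma ex1_neg_decomp:
  assumes n: "n \<le> - 2"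
  shows "\<exists>!ms. is_neg_decomp \<eta> u n ms"
  unfolding is_neg_decomp_iff[OF n]
  using n by (intro ex1_admissible growing_left period(1)) auto

text \<open>The endpoint is the letter at index \<open>n\<close> of an iterated image of
  \<open>u 0\<close>, and \<open>right_image\<close> identifies this image with a prefix of the
  right half.\<close>

lemma path_end_pos_decomp:
  assumes n: "n \<ge> 1" and ms: "is_pos_decomp \<eta> u n ms"
  shows "path \<eta> (u 0) (rev ms)" "path_end (u 0) (rev ms) = u n"
proof -
  from ms obtain q where q: "length ms = p * Suc q" and path: "path \<eta> (u 0) (rev ms)"
    and l: "length (path_word \<eta> (rev ms)) = nat n"
    and L: "nat n < length ((\<eta> ^^ (p * Suc q)) [u 0])"
    by (auto simp only: is_pos_decomp_iff[OF n])
  show "path \<eta> (u 0) (rev ms)" by fact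
  have "path_end (u 0) (rev ms) = (\<eta> ^^ (p * Suc q)) [u 0] ! nat n"
    by (simp only: path_end_nth[OF path] length_rev l q)
  also have "\<dots> = u n"
    by (subst right_image[symmetric]) (use L n in simp)
  finally show "path_end (u 0) (rev ms) = u n" .
qed

lemma path_end_neg_decomp:
  assumes n: "n \<le> - 2" and ms: "is_neg_decomp \<eta> u n ms"
  shows "path \<eta> (u (- 1)) (rev ms)" "path_end (u (- 1)) (rev ms) = u n"
proof -
  from ms obtain q where q: "length ms = p * Suc q" and path: "path \<eta> (u (- 1)) (rev ms)"
    and l: "length (path_word \<eta> (rev ms)) = nat (int (length ((\<eta> ^^ (p * Suc q)) [u (- 1)])) + n)"
    and L: "nat (- n - 1) < length ((\<eta> ^^ (p * Suc q)) [u (- 1)])"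
    by (auto simp only: is_neg_decomp_iff[OF n])
  show "path \<eta> (u (- 1)) (rev ms)" by fact
  define M where "M = length ((\<eta> ^^ (p * Suc q)) [u (- 1)])"
  have "path_end (u (- 1)) (rev ms) = (\<eta> ^^ (p * Suc q)) [u (- 1)] ! nat (int M + n)"
    by (simp only: path_end_nth[OF path] length_rev l q M_def)
  also have "\<dots> = map u [- int M..- 1] ! nat (int M + n)"
    by (simp only: M_def left_image)
  also have "\<dots> = u n"
    using L n unfolding M_def[symmetric] by auto
  finally show "path_end (u (- 1)) (rev ms) = u n" .
qed

end

section \<open>Running the automaton on the representation\<close>

theorem theorem16:
  fixes \<eta> :: "'a::finite list \<Rightarrow> 'a list" and u :: "int \<Rightarrow> 'a"
  assumes "substitution \<eta>"
    and "periodic_point \<eta> u"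
    and "growing_seed \<eta> (seed u)"
  shows "\<forall>n::int. run (subst_automaton \<eta> (seed u)) (rep \<eta> u n) = Some (Letter (u n))"
proof
  fix n :: int
  interpret growing_periodic_point \<eta> u
    using assms
    by unfold_locales (auto simp: substitution_def growing_seed_def seed_def)
  \<comment> \<open>The leading digit selects the seed letter of the half containing
    \<open>n\<close>; the remaining digits follow the path from there.\<close>
  have start: "run (subst_automaton \<eta> (seed u)) (0 # w)
        = run_from (subst_automaton \<eta> (seed u)) (Letter (u 0)) w"
      "run (subst_automaton \<eta> (seed u)) (1 # w)
        = run_from (subst_automaton \<eta> (seed u)) (Letter (u (- 1))) w" for w
    by (simp_all add: run_def subst_automaton_def seed_def)
  have digits: "digits ms = map (length \<circ> fst) (rev ms)" for ms :: "('a list \<times> 'a) list"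
    by (simp add: digits_def rev_map)
  consider "n \<ge> 1" | "n = 0" | "n = - 1" | "n \<le> - 2" by linarith
  then show "run (subst_automaton \<eta> (seed u)) (rep \<eta> u n) = Some (Letter (u n))"
  proof cases
    case 1
    define ms where "ms = (THE ms. is_pos_decomp \<eta> u n ms)"
    have "is_pos_decomp \<eta> u n ms" unfolding ms_def by (rule theI'[OF ex1_pos_decomp[OF 1]])
    note ms = path_end_pos_decomp[OF 1 this]
    have "rep \<eta> u n = 0 # digits ms" using 1 by (simp add: rep_def ms_def)
    then show ?thesis using run_from_digits[OF ms(1)] ms(2) by (simp only: start digits)
  next
    case 4
    define ms where "ms = (THE ms. is_neg_decomp \<eta> u n ms)"
    have "is_neg_decomp \<eta> u n ms" unfolding ms_def by (rule theI'[OF ex1_neg_decomp[OF 4]])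
    note ms = path_end_neg_decomp[OF 4 this]
    have "rep \<eta> u n = 1 # digits ms" using 4 by (simp add: rep_def ms_def)
    then show ?thesis using run_from_digits[OF ms(1)] ms(2) by (simp only: start digits)
  qed (simp_all add: rep_def start[simplified])
qed

end
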